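(* (Quadratic reciprocity law.) Let $p$ and $q$ be two distinct odd prime numbers. If $p\equiv q\equiv 3\pmod 4$, then $\left(\tfrac{q}{p}\right) = -\left(\tfrac{p}{q}\right)$. Otherwise (that is, if at least one of $p,q$ is congruent to $1$ modulo $4$), $\left(\tfrac{q}{p}\right) = \left(\tfrac{p}{q}\right)$.
   Context: For an odd prime $p$ and an integer $a$ not divisible by $p$, $\left(\tfrac{a}{p}\right)$ denotes the Legendre symbol: it equals $1$ if $a$ is a square modulo $p$ and $-1$ otherwise. *)

theory Defs
  imports "HOL-Number_Theory.Number_Theory"
begin

end

theory Submission
  imports Defs
begin

text \<open>The library's \<open>Quadratic_Reciprocity\<close> gives the product of the two symbols
  as -1 to the power (p-1)/2 * (q-1)/2. This exponent is odd exactly when both primes are 3 mod 4,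
  so the product is -1 in that case and 1 otherwise. Two signs with product 1 are equal; with
  product -1 they are opposite.\<close>

text \<open>Writing n = 2k + 1, the half is k, and k = 2j + 1 amounts to n = 4j + 3.\<close>

lemma odd_half_pred_iff_cong_3_mod_4:
  fixes n :: nat
  assumes "odd n"
  shows "odd ((n - 1) div 2) \<longleftrightarrow> [n = 3] (mod 4)"
  using assms unfolding cong_def by simp presburger

theorem mainTheorem1:
  fixes p q :: nat
  assumes "prime p" and "odd p" and "prime q" and "odd q" and "p \<noteq> q"
  shows "([p = 3] (mod 4) \<and> [q = 3] (mod 4) \<longrightarrow>
            Legendre (int q) (int p) = - Legendre (int p) (int q)) \<and>
         (\<not> ([p = 3] (mod 4) \<and> [q = 3] (mod 4)) \<longrightarrow>
            Legendre (int q) (int p) = Legendre (int p) (int q))"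
proof -
  have "2 < p" "2 < q"
    using assms prime_ge_2_nat[of p] prime_ge_2_nat[of q] by (auto simp: le_less)
  then have product: "Legendre (int p) (int q) * Legendre (int q) (int p)
      = (-1) ^ ((p - 1) div 2 * ((q - 1) div 2))"
    using Quadratic_Reciprocity assms by blast
  have parity: "odd ((p - 1) div 2 * ((q - 1) div 2)) \<longleftrightarrow> [p = 3] (mod 4) \<and> [q = 3] (mod 4)"
    using odd_half_pred_iff_cong_3_mod_4 assms by simp
  \<comment> \<open>\<open>Legendre\<close> is also defined on multiples of the modulus, with value
    0. Below, the nonzero product excludes this value, so coprimality of p and q need not be
    invoked. A case split on one symbol then determines the other.\<close>
  have trichotomy: "Legendre a m = 0 \<or> Legendre a m = 1 \<or> Legendre a m = -1" for a m
    by (simp add: Legendre_def)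
  show ?thesis
  proof (cases "[p = 3] (mod 4) \<and> [q = 3] (mod 4)")
    case True
    with product parity have "Legendre (int p) (int q) * Legendre (int q) (int p) = -1"
      by simp
    with True trichotomy[of "int p" "int q"] show ?thesis
      by auto
  next
    case False
    with product parity have "Legendre (int p) (int q) * Legendre (int q) (int p) = 1"
      by simp
    with False trichotomy[of "int p" "int q"] show ?thesis
      by auto
  qed
qed

end
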